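(* Let $C$ be a set and $F,G$ Plott functions on $C$. Let $(Y,Z)$ be a semi-stable pair, let $T$ be a stable set, and suppose $Y\preceq_G T$. Then the limit stable set $S=\sigma(Y,Z)$ satisfies $S\preceq_G T$.
   Context: A choice function on a set $C$ is a map $G:2^C\to 2^C$ with $G(X)\subseteq X$ for all $X\subseteq C$; it is a Plott function if $G(X\cup Y)=G(G(X)\cup Y)$ for all $X,Y\subseteq C$. For a Plott function $G$, $A\preceq_G B$ means $G(A\cup B)\subseteq B$. A pair $(Y,Z)$ of subsets of $C$ is semi-stable if $Y\cup Z=C$ and $G(Y)\subseteq F(Z)$. A subset $S\subseteq C$ is a stable set if (S1) $F(S)=S$ and $G(S)=S$, and (S2) for every $c\in C\setminus S$, either $c\notin F(S\cup\{c\})$ or $c\notin G(S\cup\{c\})$. For a semi-stable pair $(Y,Z)$ let $\Phi(Y,Z)=(Y\cup F(Z),\,(Z\setminus F(Z))\cup G(F(Z)))$. Starting from $P_0=(Y_0,Z_0)=(Y,Z)$, define a transfinite sequence of pairs $P_\alpha=(Y_\alpha,Z_\alpha)$ indexed by ordinals: $P_{\beta+1}=\Phi(P_\beta)$, and for a limit ordinal $\alpha$, $P_\alpha=(\bigcup_{\beta<\alpha}Y_\beta,\bigcap_{\beta<\alpha}Z_\beta)$. This sequence is eventually constant; its eventual value $(Y_\infty,Z_\infty)$ satisfies $G(Y_\infty)=F(Z_\infty)$, and $\sigma(Y,Z)$ denotes the stable set $G(Y_\infty)=F(Z_\infty)$. *)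

theory Defs
  imports Main
begin

(* A choice function on C is a map on 'a set of which only the values at subsets of C matter. *)
definition choice_function :: "'a set \<Rightarrow> ('a set \<Rightarrow> 'a set) \<Rightarrow> bool" where
  "choice_function C G \<longleftrightarrow> (\<forall>X. X \<subseteq> C \<longrightarrow> G X \<subseteq> X)"

definition plott_function :: "'a set \<Rightarrow> ('a set \<Rightarrow> 'a set) \<Rightarrow> bool" where
  "plott_function C G \<longleftrightarrow> choice_function C G \<and>
     (\<forall>X Y. X \<subseteq> C \<longrightarrow> Y \<subseteq> C \<longrightarrow> G (X \<union> Y) = G (G X \<union> Y))"

definition plott_le :: "('a set \<Rightarrow> 'a set) \<Rightarrow> 'a set \<Rightarrow> 'a set \<Rightarrow> bool" where
  "plott_le G A B \<longleftrightarrow> G (A \<union> B) \<subseteq> B"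

definition semi_stable ::
  "'a set \<Rightarrow> ('a set \<Rightarrow> 'a set) \<Rightarrow> ('a set \<Rightarrow> 'a set) \<Rightarrow> 'a set \<times> 'a set \<Rightarrow> bool" where
  "semi_stable C F G = (\<lambda>(Y, Z). Y \<subseteq> C \<and> Z \<subseteq> C \<and> Y \<union> Z = C \<and> G Y \<subseteq> F Z)"

definition stable_set ::
  "'a set \<Rightarrow> ('a set \<Rightarrow> 'a set) \<Rightarrow> ('a set \<Rightarrow> 'a set) \<Rightarrow> 'a set \<Rightarrow> bool" where
  "stable_set C F G S \<longleftrightarrow> S \<subseteq> C \<and> F S = S \<and> G S = S \<and>
     (\<forall>c \<in> C - S. c \<notin> F (S \<union> {c}) \<or> c \<notin> G (S \<union> {c}))"

definition Phi ::
  "('a set \<Rightarrow> 'a set) \<Rightarrow> ('a set \<Rightarrow> 'a set) \<Rightarrow> 'a set \<times> 'a set \<Rightarrow> 'a set \<times> 'a set" where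
  "Phi F G = (\<lambda>(Y, Z). (Y \<union> F Z, (Z - F Z) \<union> G (F Z)))"

(* The sequence along an arbitrary well-ordered index type. The least index plays the role of 0;
   an index with an immediate predecessor is a successor; every other index is a limit. *)
definition immediate_pred :: "'i::wellorder \<Rightarrow> 'i \<Rightarrow> bool" where
  "immediate_pred \<beta> \<alpha> \<longleftrightarrow> \<beta> < \<alpha> \<and> (\<forall>\<gamma>. \<gamma> < \<alpha> \<longrightarrow> \<gamma> \<le> \<beta>)"

lemma immediate_pred_less: "immediate_pred \<beta> \<alpha> \<Longrightarrow> (THE \<gamma>. immediate_pred \<gamma> \<alpha>) < \<alpha>"
proof -
  assume a: "immediate_pred \<beta> \<alpha>"
  then have "(THE \<gamma>. immediate_pred \<gamma> \<alpha>) = \<beta>"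
    by (intro the_equality) (auto simp: immediate_pred_def intro: order.antisym)
  with a show ?thesis by (simp add: immediate_pred_def)
qed

function trans_seq ::
  "('a set \<Rightarrow> 'a set) \<Rightarrow> ('a set \<Rightarrow> 'a set) \<Rightarrow> 'a set \<times> 'a set \<Rightarrow> 'i::wellorder \<Rightarrow> 'a set \<times> 'a set" where
  "trans_seq F G P \<alpha> =
     (if \<forall>\<beta>. \<alpha> \<le> \<beta> then P
      else if \<exists>\<beta>. immediate_pred \<beta> \<alpha> then Phi F G (trans_seq F G P (THE \<beta>. immediate_pred \<beta> \<alpha>))
      else (\<Union>\<beta>\<in>{..<\<alpha>}. fst (trans_seq F G P \<beta>), \<Inter>\<beta>\<in>{..<\<alpha>}. snd (trans_seq F G P \<beta>)))"
  by pat_completeness auto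
termination
  by (relation "inv_image {(x, y). x < y} (\<lambda>(F, G, P, \<alpha>). \<alpha>)")
     (auto intro: wf_inv_image wf immediate_pred_less)

declare trans_seq.simps [simp del]

(* HOL has no type of all ordinals. The following type is an initial segment of them: the
   initial ordinal of the cardinal of the powerset of 'a * nat, which is a limit ordinal of
   cardinality greater than that of 'a * nat. By trans_seq_eventually_const below, a sequence
   of pairs of subsets of a set of elements of type 'a is constant from some index of this
   segment on, so it reaches its eventual value there. *)
typedef 'a ordinal = "UNIV :: ('a \<times> nat) set set" by simp

instantiation ordinal :: (type) wellorder
begin

definition less_eq_ordinal :: "'a ordinal \<Rightarrow> 'a ordinal \<Rightarrow> bool" where
  "\<alpha> \<le> \<beta> \<longleftrightarrow> (Rep_ordinal \<alpha>, Rep_ordinal \<beta>) \<in> card_of (UNIV :: ('a \<times> nat) set set)"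

definition less_ordinal :: "'a ordinal \<Rightarrow> 'a ordinal \<Rightarrow> bool" where
  "(\<alpha> :: 'a ordinal) < \<beta> \<longleftrightarrow> \<alpha> \<le> \<beta> \<and> \<alpha> \<noteq> \<beta>"

instance
proof -
  let ?r = "card_of (UNIV :: ('a \<times> nat) set set)"
  have wo: "well_order_on UNIV ?r" by (rule card_of_well_order_on)
  then have ro: "refl_on UNIV ?r" and ao: "antisym ?r" and tr: "trans ?r" and to: "total_on UNIV ?r"
    by (simp_all add: well_order_on_def linear_order_on_def partial_order_on_def preorder_on_def)
  have refl: "(x, x) \<in> ?r" for x using ro by (simp add: refl_on_def)
  have total: "(x, y) \<in> ?r \<or> (y, x) \<in> ?r" for x y
    using to refl[of x] by (cases "x = y") (simp_all add: total_on_def)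
  have "wf (?r - Id)" using wo by (simp add: well_order_on_def)
  then have "wf (inv_image (?r - Id) Rep_ordinal)" by (rule wf_inv_image)
  moreover have "inv_image (?r - Id) Rep_ordinal = {(\<alpha>, \<beta> :: 'a ordinal). \<alpha> < \<beta>}"
    by (auto simp: less_ordinal_def less_eq_ordinal_def Rep_ordinal_inject)
  ultimately have wf: "wf {(\<alpha>, \<beta> :: 'a ordinal). \<alpha> < \<beta>}" by simp
  show "OFCLASS('a ordinal, wellorder_class)"
  proof
    fix \<alpha> \<beta> \<gamma> :: "'a ordinal"
    show "\<alpha> \<le> \<alpha>" by (simp add: less_eq_ordinal_def refl)
    show "\<alpha> \<le> \<beta> \<or> \<beta> \<le> \<alpha>" by (simp add: less_eq_ordinal_def total)
    show "\<alpha> \<le> \<beta> \<Longrightarrow> \<beta> \<le> \<gamma> \<Longrightarrow> \<alpha> \<le> \<gamma>" unfolding less_eq_ordinal_def by (rule transD[OF tr])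
    show anti: "\<alpha> \<le> \<beta> \<Longrightarrow> \<beta> \<le> \<alpha> \<Longrightarrow> \<alpha> = \<beta>"
      unfolding less_eq_ordinal_def using antisymD[OF ao] Rep_ordinal_inject by metis
    show "\<alpha> < \<beta> \<longleftrightarrow> \<alpha> \<le> \<beta> \<and> \<not> \<beta> \<le> \<alpha>"
      unfolding less_ordinal_def using anti refl less_eq_ordinal_def by metis
  next
    fix P :: "'a ordinal \<Rightarrow> bool" and \<alpha> :: "'a ordinal"
    assume "\<And>\<beta>. (\<And>\<gamma>. \<gamma> < \<beta> \<Longrightarrow> P \<gamma>) \<Longrightarrow> P \<beta>"
    then show "P \<alpha>" using wf_induct_rule[OF wf, of P \<alpha>] by simp
  qed
qed

end

lemma ordinal_gt_ex: "\<exists>\<beta>. \<alpha> < (\<beta> :: 'a ordinal)"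
proof -
  have "infinite (UNIV :: ('a \<times> nat) set set)"
    by (simp add: Finite_Set.finite_set finite_prod)
  then obtain b where "Rep_ordinal \<alpha> \<noteq> b" "(Rep_ordinal \<alpha>, b) \<in> card_of (UNIV :: ('a \<times> nat) set set)"
    using infinite_Card_order_limit[OF card_of_Card_order, of UNIV "Rep_ordinal \<alpha>"]
    by (auto simp: Field_card_of)
  then show ?thesis
    by (intro exI[of _ "Abs_ordinal b"])
       (auto simp: less_ordinal_def less_eq_ordinal_def Abs_ordinal_inverse)
qed

lemma not_inj_ordinal: "\<not> inj (f :: 'a ordinal \<Rightarrow> 'a \<times> nat)"
proof
  assume "inj f"
  then have "inj (f \<circ> Abs_ordinal)"
    by (intro inj_compose) (auto simp: inj_def Abs_ordinal_inject)
  then have "surj (inv (f \<circ> Abs_ordinal))" by (rule inj_imp_surj_inv)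
  then show False using Cantors_theorem[of UNIV] by (metis Pow_UNIV)
qed

lemma trans_seq_least: "\<forall>\<beta>. \<alpha> \<le> \<beta> \<Longrightarrow> trans_seq F G P \<alpha> = P"
  by (subst trans_seq.simps) simp

lemma trans_seq_succ:
  assumes "immediate_pred \<gamma> \<alpha>"
  shows "trans_seq F G P \<alpha> = Phi F G (trans_seq F G P \<gamma>)"
proof -
  have "(THE \<gamma>. immediate_pred \<gamma> \<alpha>) = \<gamma>"
    using assms by (intro the_equality) (auto simp: immediate_pred_def intro: order.antisym)
  moreover have "\<not> (\<forall>\<beta>. \<alpha> \<le> \<beta>)" using assms by (auto simp: immediate_pred_def not_le)
  ultimately show ?thesis using assms by (subst trans_seq.simps) auto
qed

lemma trans_seq_limit:
  assumes "\<not> (\<forall>\<beta>. \<alpha> \<le> \<beta>)" "\<not> (\<exists>\<beta>. immediate_pred \<beta> \<alpha>)"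
  shows "trans_seq F G P \<alpha> = (\<Union>\<beta>\<in>{..<\<alpha>}. fst (trans_seq F G P \<beta>), \<Inter>\<beta>\<in>{..<\<alpha>}. snd (trans_seq F G P \<beta>))"
  by (subst trans_seq.simps) (use assms in auto)

lemma trans_seq_subset:
  assumes "choice_function C F" "choice_function C G" "fst P \<subseteq> C" "snd P \<subseteq> C"
  shows "fst (trans_seq F G P \<alpha>) \<subseteq> C \<and> snd (trans_seq F G P \<alpha>) \<subseteq> C"
proof (induction \<alpha> rule: less_induct)
  case (less \<alpha>)
  consider "\<forall>\<beta>. \<alpha> \<le> \<beta>" | \<gamma> where "immediate_pred \<gamma> \<alpha>"
    | "\<not> (\<forall>\<beta>. \<alpha> \<le> \<beta>)" "\<not> (\<exists>\<beta>. immediate_pred \<beta> \<alpha>)" by blast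
  then show ?case
  proof cases
    case 1
    then show ?thesis using assms by (simp add: trans_seq_least)
  next
    case 2
    obtain Y Z where YZ: "trans_seq F G P \<gamma> = (Y, Z)" by fastforce
    with 2 less have "Y \<subseteq> C" "Z \<subseteq> C" by (force simp: immediate_pred_def)+
    moreover from this assms have "F Z \<subseteq> C" "G (F Z) \<subseteq> C"
      unfolding choice_function_def by (meson order_trans)+
    ultimately show ?thesis by (auto simp: trans_seq_succ[OF 2] YZ Phi_def)
  next
    case 3
    then obtain \<beta> where "\<beta> < \<alpha>" by (auto simp: not_le)
    with less show ?thesis by (fastforce simp: trans_seq_limit[OF 3])
  qed
qed

lemma trans_seq_mono:
  assumes "choice_function C F" "choice_function C G" "fst P \<subseteq> C" "snd P \<subseteq> C" "\<beta> \<le> \<alpha>"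
  shows "fst (trans_seq F G P \<beta>) \<subseteq> fst (trans_seq F G P \<alpha>) \<and>
    snd (trans_seq F G P \<alpha>) \<subseteq> snd (trans_seq F G P \<beta>)"
  using \<open>\<beta> \<le> \<alpha>\<close>
proof (induction \<alpha> rule: less_induct)
  case (less \<alpha>)
  show ?case
  proof (cases "\<beta> = \<alpha>")
    case False
    with less.prems have lt: "\<beta> < \<alpha>" by simp
    then have nl: "\<not> (\<forall>\<beta>. \<alpha> \<le> \<beta>)" by (auto simp: not_le)
    show ?thesis
    proof (cases "\<exists>\<gamma>. immediate_pred \<gamma> \<alpha>")
      case True
      then obtain \<gamma> where \<gamma>: "immediate_pred \<gamma> \<alpha>" by blast
      then have IH: "fst (trans_seq F G P \<beta>) \<subseteq> fst (trans_seq F G P \<gamma>) \<and>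
          snd (trans_seq F G P \<gamma>) \<subseteq> snd (trans_seq F G P \<beta>)"
        using lt less.IH by (simp add: immediate_pred_def)
      obtain Y Z where YZ: "trans_seq F G P \<gamma> = (Y, Z)" by fastforce
      then have Z: "Z \<subseteq> C" using trans_seq_subset[OF assms(1-4), of \<gamma>] by simp
      then have FZ: "F Z \<subseteq> Z" using assms(1) by (simp add: choice_function_def)
      then have "G (F Z) \<subseteq> F Z"
        using Z assms(2) unfolding choice_function_def by (meson order_trans)
      with FZ IH show ?thesis by (auto simp: trans_seq_succ[OF \<gamma>] YZ Phi_def)
    next
      case False
      with lt show ?thesis by (auto simp: trans_seq_limit[OF nl])
    qed
  qed simp
qed

lemma trans_seq_const:
  assumes "choice_function C F" "choice_function C G" "fst P \<subseteq> C" "snd P \<subseteq> C"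
    and fp: "Phi F G (trans_seq F G P \<alpha>) = trans_seq F G P \<alpha>" and "\<alpha> \<le> \<beta>"
  shows "trans_seq F G P \<beta> = trans_seq F G P \<alpha>"
  using \<open>\<alpha> \<le> \<beta>\<close>
proof (induction \<beta> rule: less_induct)
  case (less \<beta>)
  show ?case
  proof (cases "\<alpha> = \<beta>")
    case False
    with less.prems have lt: "\<alpha> < \<beta>" by simp
    then have nl: "\<not> (\<forall>\<gamma>. \<beta> \<le> \<gamma>)" by (auto simp: not_le)
    show ?thesis
    proof (cases "\<exists>\<gamma>. immediate_pred \<gamma> \<beta>")
      case True
      then obtain \<gamma> where \<gamma>: "immediate_pred \<gamma> \<beta>" by blast
      then have "trans_seq F G P \<gamma> = trans_seq F G P \<alpha>"
        using lt less.IH[of \<gamma>] by (simp add: immediate_pred_def)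
      with fp show ?thesis by (simp add: trans_seq_succ[OF \<gamma>])
    next
      case False
      have "fst (trans_seq F G P \<gamma>) \<subseteq> fst (trans_seq F G P \<alpha>) \<and>
          snd (trans_seq F G P \<alpha>) \<subseteq> snd (trans_seq F G P \<gamma>)" if "\<gamma> < \<beta>" for \<gamma>
        using that trans_seq_mono[OF assms(1-4), of \<gamma> \<alpha>] less.IH[of \<gamma>] by (cases "\<gamma> \<le> \<alpha>") auto
      then have "(\<Union>\<gamma>\<in>{..<\<beta>}. fst (trans_seq F G P \<gamma>)) = fst (trans_seq F G P \<alpha>)"
        "(\<Inter>\<gamma>\<in>{..<\<beta>}. snd (trans_seq F G P \<gamma>)) = snd (trans_seq F G P \<alpha>)"
        using lt by blast+
      then show ?thesis by (simp add: trans_seq_limit[OF nl False])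
    qed
  qed simp
qed

lemma trans_seq_eventually_const:
  fixes C :: "'a set"
  assumes "choice_function C F" "choice_function C G" "fst P \<subseteq> C" "snd P \<subseteq> C"
  shows "\<exists>\<alpha> :: 'a ordinal. \<forall>\<beta>\<ge>\<alpha>. trans_seq F G P \<beta> = trans_seq F G P \<alpha>"
proof (rule ccontr)
  assume "\<not> ?thesis"
  then have ne: "Phi F G (trans_seq F G P \<alpha>) \<noteq> trans_seq F G P \<alpha>" for \<alpha> :: "'a ordinal"
    using trans_seq_const[OF assms] by blast
  define s where "s \<alpha> = (LEAST \<beta>. \<alpha> < \<beta>)" for \<alpha> :: "'a ordinal"
  have s: "immediate_pred \<alpha> (s \<alpha>)" for \<alpha>
    unfolding immediate_pred_def s_def using LeastI_ex[OF ordinal_gt_ex] not_less_Least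
    by (metis not_le)
  let ?Y = "\<lambda>\<alpha> :: 'a ordinal. fst (trans_seq F G P \<alpha>)"
  let ?Z = "\<lambda>\<alpha> :: 'a ordinal. snd (trans_seq F G P \<alpha>)"
  note mono = trans_seq_mono[OF assms]
  have "\<exists>p. (snd p = (0::nat) \<and> fst p \<in> ?Y (s \<alpha>) - ?Y \<alpha>) \<or> (snd p = 1 \<and> fst p \<in> ?Z \<alpha> - ?Z (s \<alpha>))" for \<alpha>
  proof -
    have "trans_seq F G P (s \<alpha>) \<noteq> trans_seq F G P \<alpha>"
      using ne trans_seq_succ[OF s] by metis
    moreover have "\<alpha> \<le> s \<alpha>" using s by (simp add: immediate_pred_def less_imp_le)
    ultimately have "(\<exists>x. x \<in> ?Y (s \<alpha>) - ?Y \<alpha>) \<or> (\<exists>x. x \<in> ?Z \<alpha> - ?Z (s \<alpha>))"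
      using mono[of \<alpha> "s \<alpha>"] by (auto simp: prod_eq_iff)
    then show ?thesis by auto
  qed
  then obtain f :: "'a ordinal \<Rightarrow> 'a \<times> nat" where
    f: "\<And>\<alpha>. (snd (f \<alpha>) = 0 \<and> fst (f \<alpha>) \<in> ?Y (s \<alpha>) - ?Y \<alpha>) \<or> (snd (f \<alpha>) = 1 \<and> fst (f \<alpha>) \<in> ?Z \<alpha> - ?Z (s \<alpha>))"
    by metis
  have neq: "f \<alpha> \<noteq> f \<beta>" if "\<alpha> < \<beta>" for \<alpha> \<beta>
  proof -
    have "s \<alpha> \<le> \<beta>" using that by (simp add: s_def Least_le)
    then show ?thesis using f[of \<alpha>] f[of \<beta>] mono[of "s \<alpha>" \<beta>] by auto
  qed
  then have "inj f" by (metis injI linorder_less_linear)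
  then show False using not_inj_ordinal by blast
qed

definition limit_pair ::
  "('a set \<Rightarrow> 'a set) \<Rightarrow> ('a set \<Rightarrow> 'a set) \<Rightarrow> 'a set \<times> 'a set \<Rightarrow> 'a set \<times> 'a set" where
  "limit_pair F G P = (THE Q. \<exists>\<alpha> :: 'a ordinal. \<forall>\<beta>\<ge>\<alpha>. trans_seq F G P \<beta> = Q)"

(* For Plott functions F, G and a semi-stable P with limit pair (Y, Z), G Y = F Z. *)
definition sigma ::
  "('a set \<Rightarrow> 'a set) \<Rightarrow> ('a set \<Rightarrow> 'a set) \<Rightarrow> 'a set \<times> 'a set \<Rightarrow> 'a set" where
  "sigma F G P = G (fst (limit_pair F G P))"

end

(* The relation A \<preceq> T says exactly that no element a of A outside T is chosen from T \<union> {a}, so it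
   can be checked elementwise. Along the sequence, semi-stability and Y \<preceq> T persist together: they
   give T \<subseteq> Z, so every f in F Z - T lies in F (T \<union> {f}) by heredity, and stability of T forbids
   f from being in G (T \<union> {f}). Hence (Y \<union> F Z) \<preceq> T, and limits follow elementwise. *)
theory Submission
  imports Defs
begin

section \<open>Choice from smaller sets, and \<open>plott_le\<close> element by element\<close>

lemma plott_choice: "plott_function C G \<Longrightarrow> choice_function C G"
  by (simp add: plott_function_def)

lemma plott_subset: "plott_function C G \<Longrightarrow> X \<subseteq> C \<Longrightarrow> G X \<subseteq> X"
  by (simp add: plott_function_def choice_function_def)

lemma plott_Un: "plott_function C G \<Longrightarrow> X \<subseteq> C \<Longrightarrow> Y \<subseteq> C \<Longrightarrow> G (X \<union> Y) = G (G X \<union> Y)"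
  by (simp add: plott_function_def)

text \<open>Split \<open>Y\<close> into \<open>X\<close> and \<open>Y - X\<close>. Path independence
  replaces \<open>X\<close> by \<open>G X\<close>, so \<open>G Y\<close> chooses from
  \<open>G X \<union> (Y - X)\<close>, and the only members of \<open>X\<close> there are those of
  \<open>G X\<close>.\<close>

lemma plott_heredity:
  assumes G: "plott_function C G" and "X \<subseteq> Y" "Y \<subseteq> C" "x \<in> X" "x \<in> G Y"
  shows "x \<in> G X"
proof -
  have XC: "X \<subseteq> C" and DC: "Y - X \<subseteq> C" using assms by auto
  have "X \<union> (Y - X) = Y" using assms by auto
  then have "G Y = G (G X \<union> (Y - X))" using plott_Un[OF G XC DC] by simp
  moreover have "G X \<union> (Y - X) \<subseteq> C" using plott_subset[OF G XC] XC DC by blast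
  ultimately have "G Y \<subseteq> G X \<union> (Y - X)" using plott_subset[OF G] by metis
  with assms show ?thesis by blast
qed

text \<open>Rejected elements may be discarded without changing the choice: in the Plott identity
  for \<open>A\<close> and \<open>B\<close>, the union is \<open>A\<close> before \<open>A\<close>
  is replaced by \<open>G A\<close> and \<open>B\<close> afterwards.\<close>

lemma plott_outcast:
  assumes G: "plott_function C G" and "A \<subseteq> C" "G A \<subseteq> B" "B \<subseteq> A"
  shows "G B = G A"
proof -
  have "B \<subseteq> C" using assms by auto
  then have "G (A \<union> B) = G (G A \<union> B)" using assms plott_Un by metis
  moreover have "A \<union> B = A" "G A \<union> B = B" using assms by auto
  ultimately show ?thesis by simp
qed

text \<open>The right-hand side tests each \<open>a\<close> separately, so it passes to subsets and
  to arbitrary unions of \<open>A\<close>; both uses occur below.\<close>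

lemma plott_le_iff:
  assumes G: "plott_function C G" and AC: "A \<subseteq> C" and TC: "T \<subseteq> C"
  shows "plott_le G A T \<longleftrightarrow> (\<forall>a \<in> A - T. a \<notin> G (T \<union> {a}))"
proof
  assume le: "plott_le G A T"
  show "\<forall>a \<in> A - T. a \<notin> G (T \<union> {a})"
  proof
    fix a assume a: "a \<in> A - T"
    \<comment> \<open>\<open>T \<union> {a}\<close> lies between \<open>G (A \<union> T)\<close>, a
      subset of \<open>T\<close> by \<open>le\<close>, and \<open>A \<union> T\<close>.\<close>
    have "G (T \<union> {a}) = G (A \<union> T)"
      by (rule plott_outcast[OF G]) (use a AC TC le in \<open>auto simp: plott_le_def\<close>)
    with le a show "a \<notin> G (T \<union> {a})" by (auto simp: plott_le_def)
  qed
next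
  assume *: "\<forall>a \<in> A - T. a \<notin> G (T \<union> {a})"
  show "plott_le G A T"
    unfolding plott_le_def
  proof
    fix x assume x: "x \<in> G (A \<union> T)"
    then have xAT: "x \<in> A \<union> T" using plott_subset[OF G, of "A \<union> T"] AC TC by auto
    then have "x \<in> G (T \<union> {x})"
      by (intro plott_heredity[OF G, of "T \<union> {x}" "A \<union> T"]) (use x AC TC in auto)
    with * xAT show "x \<in> T" by blast
  qed
qed

section \<open>One application of \<open>Phi\<close>\<close>

text \<open>Since \<open>G Y \<subseteq> F Z\<close>, path independence gives
  \<open>G (Y \<union> F Z) = G (F Z)\<close>. These elements are kept in the reduced second
  component, and being chosen by \<open>F\<close> from \<open>Z\<close> they are still chosen from
  this smaller set.\<close>

lemma semi_stable_Phi: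
  assumes F: "plott_function C F" and G: "plott_function C G"
    and ss: "semi_stable C F G (Y, Z)"
  shows "semi_stable C F G (Phi F G (Y, Z))"
proof -
  let ?Z' = "(Z - F Z) \<union> G (F Z)"
  have YC: "Y \<subseteq> C" and ZC: "Z \<subseteq> C" and YZ: "Y \<union> Z = C" and GY: "G Y \<subseteq> F Z"
    using ss by (auto simp: semi_stable_def)
  have FZ: "F Z \<subseteq> Z" using plott_subset[OF F ZC] .
  then have FC: "F Z \<subseteq> C" using ZC by simp
  have GF: "G (F Z) \<subseteq> F Z" using plott_subset[OF G FC] .
  have "G Y \<union> F Z = F Z" using GY by auto
  then have "G (Y \<union> F Z) = G (F Z)" using plott_Un[OF G YC FC] by simp
  moreover have "G (F Z) \<subseteq> F ?Z'"
    by (intro subsetI plott_heredity[OF F, of ?Z' Z]) (use FZ GF ZC in auto)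
  ultimately show ?thesis
    using YC ZC YZ FZ GF by (auto simp: semi_stable_def Phi_def)
qed

lemma plott_le_Phi:
  assumes F: "plott_function C F" and G: "plott_function C G"
    and ss: "semi_stable C F G (Y, Z)" and T: "stable_set C F G T" and le: "plott_le G Y T"
  shows "plott_le G (fst (Phi F G (Y, Z))) T"
proof -
  have YC: "Y \<subseteq> C" and ZC: "Z \<subseteq> C" and YZ: "Y \<union> Z = C" and GY: "G Y \<subseteq> F Z"
    using ss by (auto simp: semi_stable_def)
  have TC: "T \<subseteq> C" and GT: "G T = T"
    and S2: "\<And>c. c \<in> C - T \<Longrightarrow> c \<notin> F (T \<union> {c}) \<or> c \<notin> G (T \<union> {c})"
    using T by (auto simp: stable_set_def)
  have FZ: "F Z \<subseteq> Z" using plott_subset[OF F ZC] .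
  \<comment> \<open>\<open>T\<close> lies between \<open>G (Y \<union> T)\<close> and
    \<open>Y \<union> T\<close>, so the choice from \<open>Y \<union> T\<close> is
    \<open>G T\<close>.\<close>
  have GYT: "G (Y \<union> T) = T"
    using plott_outcast[OF G, of "Y \<union> T" T] le YC TC GT by (auto simp: plott_le_def)
  have TZ: "T \<subseteq> Z"
  proof
    fix t assume t: "t \<in> T"
    \<comment> \<open>Such a \<open>t\<close> is chosen from \<open>Y \<union> T\<close>, hence by
      heredity from \<open>Y\<close>, and \<open>G Y \<subseteq> F Z \<subseteq> Z\<close>.\<close>
    have "t \<in> Z" if "t \<in> Y"
      using plott_heredity[OF G, of Y "Y \<union> T" t] that t GYT YC TC GY FZ by auto
    with t TC YZ show "t \<in> Z" by auto
  qed
  have "a \<notin> G (T \<union> {a})" if "a \<in> Y \<union> F Z - T" for a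
  proof (cases "a \<in> Y")
    case True
    with that le show ?thesis using plott_le_iff[OF G YC TC] by auto
  next
    case False
    then have "a \<in> F (T \<union> {a})"
      using that by (intro plott_heredity[OF F, of "T \<union> {a}" Z]) (use TZ FZ ZC in auto)
    with S2[of a] that False FZ ZC show ?thesis by blast
  qed
  moreover have "Y \<union> F Z \<subseteq> C" using YC FZ ZC by auto
  ultimately show ?thesis
    using plott_le_iff[OF G _ TC, of "Y \<union> F Z"] by (simp add: Phi_def)
qed

section \<open>Limit stages\<close>

text \<open>An element chosen from the union lies in the first components from some index
  \<open>i\<close> on. Heredity and semi-stability put it in \<open>F (snd (p j))\<close> for all
  later \<open>j\<close>, and heredity for \<open>F\<close> carries this down to the
  intersection.\<close>

lemma semi_stable_Union_Inter:
  fixes p :: "'i::linorder \<Rightarrow> 'a set \<times> 'a set"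
  assumes F: "plott_function C F" and G: "plott_function C G" and "I \<noteq> {}"
    and ss: "\<And>i. i \<in> I \<Longrightarrow> semi_stable C F G (p i)"
    and mono: "\<And>i j. i \<in> I \<Longrightarrow> j \<in> I \<Longrightarrow> i \<le> j \<Longrightarrow> fst (p i) \<subseteq> fst (p j) \<and> snd (p j) \<subseteq> snd (p i)"
  shows "semi_stable C F G (\<Union>i\<in>I. fst (p i), \<Inter>i\<in>I. snd (p i))"
proof -
  let ?Y = "\<Union>i\<in>I. fst (p i)" and ?Z = "\<Inter>i\<in>I. snd (p i)"
  have YC: "fst (p i) \<subseteq> C" and ZC: "snd (p i) \<subseteq> C" and YZ: "fst (p i) \<union> snd (p i) = C"
    and GY: "G (fst (p i)) \<subseteq> F (snd (p i))" if "i \<in> I" for i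
    using ss[OF that] by (auto simp: semi_stable_def split: prod.splits)
  have UC: "?Y \<subseteq> C" using YC by blast
  have "x \<in> F ?Z" if x: "x \<in> G ?Y" for x
  proof -
    obtain i where i: "i \<in> I" "x \<in> fst (p i)" using x plott_subset[OF G UC] by auto
    have later: "x \<in> F (snd (p j))" if j: "j \<in> I" "i \<le> j" for j
    proof -
      have "x \<in> fst (p j)" using mono[OF i(1) j] i(2) by blast
      then have "x \<in> G (fst (p j))"
        using plott_heredity[OF G, of "fst (p j)" ?Y x] UC x j(1) by blast
      then show ?thesis using GY[OF j(1)] by blast
    qed
    have "x \<in> snd (p j)" if j: "j \<in> I" for j
    proof -
      \<comment> \<open>The index \<open>max i j\<close> is late enough for \<open>later\<close>,
        and its second component is contained in that of \<open>j\<close>.\<close>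
      have m: "max i j \<in> I" using i(1) j by (simp add: max_def)
      then have "x \<in> snd (p (max i j))"
        using later[OF m] plott_subset[OF F ZC[OF m]] by auto
      then show ?thesis using mono[OF j m] by auto
    qed
    then have "x \<in> ?Z" by blast
    moreover have "?Z \<subseteq> snd (p i)" using i(1) by blast
    ultimately show ?thesis
      using plott_heredity[OF F, of ?Z "snd (p i)" x] ZC[OF i(1)] later[OF i(1)] by blast
  qed
  \<comment> \<open>Over an empty \<open>I\<close> the intersection would be
    \<open>UNIV\<close>.\<close>
  moreover have "?Z \<subseteq> C" using \<open>I \<noteq> {}\<close> ZC by blast
  moreover have "C \<subseteq> ?Y \<union> ?Z" using YZ by blast
  ultimately show ?thesis using UC by (auto simp: semi_stable_def)
qed

lemma plott_le_UN:
  assumes G: "plott_function C G" and TC: "T \<subseteq> C"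
    and YC: "\<And>i. i \<in> I \<Longrightarrow> Y i \<subseteq> C" and le: "\<And>i. i \<in> I \<Longrightarrow> plott_le G (Y i) T"
  shows "plott_le G (\<Union>i\<in>I. Y i) T"
proof -
  have "(\<Union>i\<in>I. Y i) \<subseteq> C" using YC by blast
  moreover have "a \<notin> G (T \<union> {a})" if "i \<in> I" "a \<in> Y i - T" for i a
    using plott_le_iff[OF G YC[OF that(1)] TC] le[OF that(1)] that(2) by simp
  ultimately show ?thesis using plott_le_iff[OF G _ TC] by auto
qed

section \<open>Transfinite induction and the eventual value\<close>

text \<open>Both properties go through a single induction because at a successor
  \<open>plott_le_Phi\<close> requires the preceding pair to be semi-stable.\<close>

lemma trans_seq_semi_stable_plott_le:
  fixes \<alpha> :: "'i::wellorder"
  assumes F: "plott_function C F" and G: "plott_function C G"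
    and ss: "semi_stable C F G P" and T: "stable_set C F G T" and le: "plott_le G (fst P) T"
  shows "semi_stable C F G (trans_seq F G P \<alpha>) \<and> plott_le G (fst (trans_seq F G P \<alpha>)) T"
proof (induction \<alpha> rule: less_induct)
  case (less \<alpha>)
  have PC: "fst P \<subseteq> C" "snd P \<subseteq> C"
    using ss by (auto simp: semi_stable_def split: prod.splits)
  have TC: "T \<subseteq> C" using T by (simp add: stable_set_def)
  note choice = plott_choice[OF F] plott_choice[OF G] PC
  consider "\<forall>\<beta>. \<alpha> \<le> \<beta>" | \<gamma> where "immediate_pred \<gamma> \<alpha>"
    | "\<not> (\<forall>\<beta>. \<alpha> \<le> \<beta>)" "\<not> (\<exists>\<beta>. immediate_pred \<beta> \<alpha>)" by blast
  then show ?case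
  proof cases
    case 1
    then show ?thesis using ss le by (simp add: trans_seq_least)
  next
    case 2
    obtain Y Z where YZ: "trans_seq F G P \<gamma> = (Y, Z)" by fastforce
    have "\<gamma> < \<alpha>" using 2 by (simp add: immediate_pred_def)
    from less.IH[OF this] YZ have "semi_stable C F G (Y, Z)" "plott_le G Y T" by simp_all
    then show ?thesis
      using semi_stable_Phi[OF F G] plott_le_Phi[OF F G _ T]
      by (simp add: trans_seq_succ[OF 2] YZ)
  next
    case 3
    then have ne: "{..<\<alpha>} \<noteq> {}" by (auto simp: not_le)
    have "semi_stable C F G (\<Union>\<beta>\<in>{..<\<alpha>}. fst (trans_seq F G P \<beta>), \<Inter>\<beta>\<in>{..<\<alpha>}. snd (trans_seq F G P \<beta>))"
    proof (rule semi_stable_Union_Inter[OF F G ne])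
      show "semi_stable C F G (trans_seq F G P \<beta>)" if "\<beta> \<in> {..<\<alpha>}" for \<beta>
        using less.IH[of \<beta>] that by simp
    qed (rule trans_seq_mono[OF choice])
    moreover have "plott_le G (\<Union>\<beta>\<in>{..<\<alpha>}. fst (trans_seq F G P \<beta>)) T"
    proof (rule plott_le_UN[OF G TC])
      show "fst (trans_seq F G P \<beta>) \<subseteq> C" for \<beta> :: 'i
        using trans_seq_subset[OF choice] by blast
      show "plott_le G (fst (trans_seq F G P \<beta>)) T" if "\<beta> \<in> {..<\<alpha>}" for \<beta>
        using less.IH[of \<beta>] that by simp
    qed
    ultimately show ?thesis by (simp add: trans_seq_limit[OF 3])
  qed
qed

text \<open>Realising the eventual value at an actual index makes the invariants of the sequence
  available for it.\<close>

lemma limit_pair_eq_trans_seq: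
  fixes C :: "'a set"
  assumes "choice_function C F" "choice_function C G" "fst P \<subseteq> C" "snd P \<subseteq> C"
  shows "\<exists>\<alpha> :: 'a ordinal. limit_pair F G P = trans_seq F G P \<alpha>"
proof -
  obtain \<alpha> :: "'a ordinal" where \<alpha>: "\<forall>\<beta>\<ge>\<alpha>. trans_seq F G P \<beta> = trans_seq F G P \<alpha>"
    using trans_seq_eventually_const[OF assms] by blast
  have "limit_pair F G P = trans_seq F G P \<alpha>"
    unfolding limit_pair_def
  proof (rule the_equality)
    show "\<exists>\<gamma> :: 'a ordinal. \<forall>\<beta>\<ge>\<gamma>. trans_seq F G P \<beta> = trans_seq F G P \<alpha>" using \<alpha> by blast
  next
    fix Q assume "\<exists>\<gamma> :: 'a ordinal. \<forall>\<beta>\<ge>\<gamma>. trans_seq F G P \<beta> = Q"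
    then obtain \<gamma> :: "'a ordinal" where "\<forall>\<beta>\<ge>\<gamma>. trans_seq F G P \<beta> = Q" by blast
    \<comment> \<open>At the index \<open>max \<alpha> \<gamma>\<close> the sequence takes both
      values.\<close>
    with \<alpha> show "Q = trans_seq F G P \<alpha>" by (metis max.cobounded1 max.cobounded2)
  qed
  then show ?thesis by blast
qed

theorem theorem1:
  fixes C Y Z T :: "'a set" and F G :: "'a set \<Rightarrow> 'a set"
  assumes "plott_function C F" and "plott_function C G"
    and "semi_stable C F G (Y, Z)"
    and "stable_set C F G T"
    and "plott_le G Y T"
  shows "plott_le G (sigma F G (Y, Z)) T"
proof -
  have C: "fst (Y, Z) \<subseteq> C" "snd (Y, Z) \<subseteq> C" and TC: "T \<subseteq> C"
    using assms(3,4) by (auto simp: semi_stable_def stable_set_def)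
  note choice = plott_choice[OF assms(1)] plott_choice[OF assms(2)] C
  obtain \<alpha> :: "'a ordinal" where \<alpha>: "limit_pair F G (Y, Z) = trans_seq F G (Y, Z) \<alpha>"
    using limit_pair_eq_trans_seq[OF choice] by blast
  let ?Y = "fst (trans_seq F G (Y, Z) \<alpha>)"
  have YC: "?Y \<subseteq> C" using trans_seq_subset[OF choice] by blast
  have le: "plott_le G ?Y T"
    using trans_seq_semi_stable_plott_le[OF assms(1-4), of \<alpha>] assms(5) by simp
  have GY: "G ?Y \<subseteq> ?Y" using plott_subset[OF assms(2) YC] .
  then have "G ?Y \<subseteq> C" using YC by simp
  \<comment> \<open>The elementwise criterion for \<open>?Y\<close> restricts to its subset
    \<open>G ?Y\<close>, which is \<open>sigma F G (Y, Z)\<close>.\<close>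
  then have "plott_le G (G ?Y) T"
    using le GY by (auto simp: plott_le_iff[OF assms(2) _ TC] YC)
  then show ?thesis by (simp add: sigma_def \<alpha>)
qed

end
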